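(* A regular quasi-Leontief function $u:\mathbb{R}^n_{++}\to\mathbb{R}_{+}$ is a Leontief function if and only if it is homogeneous, i.e. $u(tx)=t\,u(x)$ for all $t>0$ and all $x\in\mathbb{R}^n_{++}$.
   Context: $\mathbb{R}_+=\{t\in\mathbb{R}:t\geqslant 0\}$, $\mathbb{R}_{++}=\{t\in\mathbb{R}:t>0\}$ and $\mathbb{R}^n_{++}=(\mathbb{R}_{++})^n$ with the coordinatewise partial order, where $n$ is a positive integer. $u$ is a Leontief function if there is $a=(a_1,\dots,a_n)\in\mathbb{R}^n_{++}$ such that $u(x)=\min_{1\leqslant i\leqslant n}a_ix_i$ for all $x$. For a partially ordered set $X$ and a totally ordered set $\Lambda$, a function $u:X\to\Lambda$ is quasi-Leontief if for every $x\in X$ there is $x^\circ\in X$ with $\{x'\in X:u(x')\geqslant u(x)\}=\{x'\in X:x'\geqslant x^\circ\}$; a quasi-Leontief function $u$ is regular if for every $\lambda\in\Lambda$ the set $\{x\in X:u(x)\geqslant\lambda\}$ is either empty or has a smallest element. Here $X=\mathbb{R}^n_{++}$ and $\Lambda=\mathbb{R}_{+}$. *)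

theory Defs
  imports "HOL-Analysis.Analysis"
begin

(* The partially ordered set X and the totally ordered set Lambda are subsets of ordered types,
   with the induced orders. *)

definition quasi_leontief_on :: "'a::order set \<Rightarrow> 'b::linorder set \<Rightarrow> ('a \<Rightarrow> 'b) \<Rightarrow> bool" where
  "quasi_leontief_on X \<Lambda> u \<longleftrightarrow>
     u \<in> X \<rightarrow> \<Lambda> \<and>
     (\<forall>x\<in>X. \<exists>x0\<in>X. {x'\<in>X. u x' \<ge> u x} = {x'\<in>X. x' \<ge> x0})"

definition has_smallest_element :: "'a::order set \<Rightarrow> bool" where
  "has_smallest_element S \<longleftrightarrow> (\<exists>m\<in>S. \<forall>y\<in>S. m \<le> y)"

definition regular_quasi_leontief_on :: "'a::order set \<Rightarrow> 'b::linorder set \<Rightarrow> ('a \<Rightarrow> 'b) \<Rightarrow> bool" where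
  "regular_quasi_leontief_on X \<Lambda> u \<longleftrightarrow>
     quasi_leontief_on X \<Lambda> u \<and>
     (\<forall>l\<in>\<Lambda>. {x\<in>X. u x \<ge> l} = {} \<or> has_smallest_element {x\<in>X. u x \<ge> l})"

(* The order on the type of vectors is the coordinatewise one; the index type is finite and
   nonempty, so n = CARD('n) is an arbitrary positive integer. *)
definition pos_orthant :: "(real ^ 'n) set" where
  "pos_orthant = {x. \<forall>i. 0 < x $ i}"

(* Functions on the open orthant are represented by total functions whose values outside it are
   irrelevant. *)
definition leontief :: "(real ^ 'n \<Rightarrow> real) \<Rightarrow> bool" where
  "leontief u \<longleftrightarrow> (\<exists>a\<in>pos_orthant. \<forall>x\<in>pos_orthant. u x = (MIN i. a $ i * x $ i))"

definition homogeneous :: "(real ^ 'n \<Rightarrow> real) \<Rightarrow> bool" where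
  "homogeneous u \<longleftrightarrow> (\<forall>t>0. \<forall>x\<in>pos_orthant. u (t *\<^sub>R x) = t * u x)"

(* The open orthant has no smallest element, so with values in {0..} the level 0 violates
   regularity for every u.  Quasi-Leontief functions on the open orthant never take the value 0,
   so they may equally be regarded as functions into {0<..}; regularity with respect to {0<..} is
   satisfiable, for instance by every Leontief function.  Hence both codomains matter. *)

end

theory Submission
  imports Defs
begin

text \<open>If \<open>u\<close> is homogeneous with \<open>c = u(1) > 0\<close>, then \<open>u x \<ge> s c\<close> iff \<open>u (x/s) \<ge> c\<close>
  iff \<open>x/s \<ge> x0\<close>, where \<open>x0\<close> is the smallest element of \<open>{u \<ge> c}\<close>. Hence
  \<open>u x = c min (x\<^sub>i / x0\<^sub>i)\<close>.\<close>

lemma homogeneous_if_leontief: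
  fixes u :: "real ^ 'n \<Rightarrow> real"
  assumes "leontief u"
  shows "homogeneous u"
proof -
  obtain a where u: "u x = (MIN i. a $ i * x $ i)" if "x \<in> pos_orthant" for x
    using assms unfolding leontief_def by blast
  show ?thesis
    unfolding homogeneous_def
  proof (intro allI impI ballI)
    fix t :: real and x :: "real ^ 'n"
    assume t: "0 < t" and x: "x \<in> pos_orthant"
    have tx: "t *\<^sub>R x \<in> pos_orthant"
      using t x by (simp add: pos_orthant_def)
    \<comment> \<open>Monotonicity, which uses t > 0, lets the scaling pass through the minimum of a
      finite nonempty set.\<close>
    have "mono ((*) t)"
      using t by (simp add: mono_def)
    then have "t * (MIN i. a $ i * x $ i) = Min ((*) t ` range (\<lambda>i. a $ i * x $ i))"
      by (intro mono_Min_commute) auto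
    also have "\<dots> = (MIN i. a $ i * (t *\<^sub>R x) $ i)"
      by (simp add: image_image mult.left_commute)
    finally show "u (t *\<^sub>R x) = t * u x"
      using u[OF x] u[OF tx] by simp
  qed
qed

text \<open>A zero of \<open>u\<close> would make the whole open orthant an upper set with a smallest element.\<close>

lemma quasi_leontief_on_pos_orthant_pos:
  fixes u :: "real ^ 'n \<Rightarrow> real"
  assumes ql: "quasi_leontief_on pos_orthant {0..} u" and x: "x \<in> pos_orthant"
  shows "0 < u x"
proof (rule ccontr)
  assume "\<not> 0 < u x"
  moreover have nonneg: "0 \<le> u y" if "y \<in> pos_orthant" for y
    using ql that by (auto simp: quasi_leontief_on_def)
  ultimately have "u x = 0"
    using x by force
  then obtain m where m: "m \<in> pos_orthant"
    and eq: "{y \<in> pos_orthant. u y \<ge> 0} = {y \<in> pos_orthant. y \<ge> m}"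
    using ql x unfolding quasi_leontief_on_def by metis
  \<comment> \<open>By nonnegativity the level set of 0 is the whole orthant, so it contains
    \<open>m / 2\<close>, which \<open>m\<close> fails to bound from below.\<close>
  have half: "(1/2) *\<^sub>R m \<in> pos_orthant"
    using m by (simp add: pos_orthant_def)
  then have "m \<le> (1/2) *\<^sub>R m"
    using eq nonneg by blast
  then have "m $ i \<le> m $ i / 2" for i
    by (simp add: less_eq_vec_def)
  moreover have "0 < m $ i" for i
    using m by (simp add: pos_orthant_def)
  ultimately have "0 < m $ i \<and> m $ i \<le> m $ i / 2" for i
    by blast
  \<comment> \<open>Any single coordinate gives the contradiction; \<open>undefined\<close> merely
    names one.\<close>
  from this[of undefined] show False
    by linarith
qed

lemma leontief_if_homogeneous:
  fixes u :: "real ^ 'n \<Rightarrow> real"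
  assumes ql: "quasi_leontief_on pos_orthant {0..} u" and hom: "homogeneous u"
  shows "leontief u"
proof -
  define e :: "real ^ 'n" where "e = (\<chi> i. 1)"
  define c where "c = u e"
  have e: "e \<in> pos_orthant"
    by (simp add: e_def pos_orthant_def)
  have c: "0 < c"
    unfolding c_def using quasi_leontief_on_pos_orthant_pos[OF ql e] .
  obtain m where m: "m \<in> pos_orthant"
    and eq: "{y \<in> pos_orthant. u y \<ge> c} = {y \<in> pos_orthant. y \<ge> m}"
    using ql e unfolding quasi_leontief_on_def c_def by blast
  have mpos: "0 < m $ i" for i
    using m by (simp add: pos_orthant_def)
  \<comment> \<open>These weights are forced: the corner \<open>m\<close> of the level set of
    \<open>c\<close> must satisfy \<open>a $ i * m $ i = c\<close> for every i.\<close>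
  define a :: "real ^ 'n" where "a = (\<chi> i. c / m $ i)"
  have a: "a \<in> pos_orthant"
    using c mpos by (simp add: a_def pos_orthant_def)
  have level: "r \<le> u x \<longleftrightarrow> r \<le> (MIN i. a $ i * x $ i)"
    if r: "0 < r" and x: "x \<in> pos_orthant" for r x
  proof -
    \<comment> \<open>Rescaling carries level \<open>r\<close> to level \<open>c\<close>, where the
      smallest point \<open>m\<close> is known.\<close>
    define y where "y = (c / r) *\<^sub>R x"
    have y: "y \<in> pos_orthant"
      using c r x by (simp add: y_def pos_orthant_def)
    have "u y = c / r * u x"
      using hom c r x by (simp add: y_def homogeneous_def)
    then have "r \<le> u x \<longleftrightarrow> c \<le> u y"
      using c r by (simp add: pos_le_divide_eq)
    also have "\<dots> \<longleftrightarrow> m \<le> y"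
      using eq y by blast
    also have "\<dots> \<longleftrightarrow> (\<forall>i. r \<le> a $ i * x $ i)"
      using r mpos by (simp add: less_eq_vec_def y_def a_def field_simps)
    also have "\<dots> \<longleftrightarrow> r \<le> (MIN i. a $ i * x $ i)"
      by (subst Min_ge_iff) auto
    finally show ?thesis .
  qed
  have "u x = (MIN i. a $ i * x $ i)" if x: "x \<in> pos_orthant" for x
  \<comment> \<open>Both sides are positive, so each can serve as the threshold \<open>r\<close> in
    \<open>level\<close>, giving one inequality each.\<close>
  proof (rule antisym)
    show "u x \<le> (MIN i. a $ i * x $ i)"
      using level[OF quasi_leontief_on_pos_orthant_pos[OF ql x] x] by simp
    have "0 < (MIN i. a $ i * x $ i)"
      using a x by (subst Min_gr_iff) (auto simp: pos_orthant_def)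
    then show "(MIN i. a $ i * x $ i) \<le> u x"
      using level x by blast
  qed
  then show ?thesis
    using a unfolding leontief_def by blast
qed

theorem proposition2p3p7:
  fixes u :: "real ^ 'n \<Rightarrow> real"
  shows "(regular_quasi_leontief_on pos_orthant {0..} u \<longrightarrow> (leontief u \<longleftrightarrow> homogeneous u)) \<and>
         (regular_quasi_leontief_on pos_orthant {0<..} u \<longrightarrow> (leontief u \<longleftrightarrow> homogeneous u))"
proof -
  \<comment> \<open>The condition on upper level sets does not mention the codomain, so enlarging it
    preserves the property and one argument covers both cases.\<close>
  have "quasi_leontief_on pos_orthant {0<..} u \<Longrightarrow> quasi_leontief_on pos_orthant {0..} u"
    by (auto simp: quasi_leontief_on_def Pi_iff intro: less_imp_le)
  then show ?thesis
    using homogeneous_if_leontief leontief_if_homogeneous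
    unfolding regular_quasi_leontief_on_def by blast
qed

end
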